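(* Let $1\leq p<\infty$ and let $X,Y$ be real Banach spaces. If $B_X$ is weakly $p$-precompact, then a bounded subset $M$ of $K(X,Y)$ is equicompact if and only if $M$ is uniformly $p$-convergent.
   Context: $B_X$ is the closed unit ball of $X$; $L(X,Y)$ and $K(X,Y)$ are the spaces of bounded linear and of compact operators $X\to Y$. A sequence $(x_n)_n$ in $X$ is weakly $p$-summable if $(x^*(x_n))_n\in\ell_p$ for every $x^*\in X^*$; $\ell_p^w(X)$ denotes the set of such sequences. A sequence $(x_n)_n$ is weakly $p$-Cauchy if $(x_{m_k}-x_{n_k})_k\in\ell_p^w(X)$ for all increasing sequences $(m_k)_k,(n_k)_k$ of positive integers. A subset of $X$ is weakly $p$-precompact if every sequence from it has a weakly $p$-Cauchy subsequence. A set $K\subset L(X,Y)$ is uniformly $p$-convergent if $\lim_n\sup_{T\in K}\|T(x_n)\|=0$ for every $(x_n)_n\in\ell_p^w(X)$. A set $M\subset K(X,Y)$ is equicompact if there is a norm-null sequence $(x_n^* )_n$ in $X^*$ with $\|T(x)\|\leq\sup_n|x_n^*(x)|$ for all $x\in X$ and $T\in M$; equivalently, every bounded sequence $(x_n)_n$ in $X$ has a subsequence $(x_{k_n})_n$ such that $(Tx_{k_n})_n$ converges uniformly for $T\in M$. *)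

theory Defs
  imports "HOL-Analysis.Analysis"
begin

definition little_lp :: "real \<Rightarrow> (nat \<Rightarrow> real) set" where
  "little_lp p = {a. summable (\<lambda>n. \<bar>a n\<bar> powr p)}"

definition weakly_p_summable :: "real \<Rightarrow> (nat \<Rightarrow> 'a::real_normed_vector) set" where
  "weakly_p_summable p =
     {x. \<forall>f :: 'a \<Rightarrow>\<^sub>L real. (\<lambda>n. blinfun_apply f (x n)) \<in> little_lp p}"

text \<open>Increasing index sequences are strictly increasing: if constant index sequences were
  allowed, only constant sequences would satisfy the following condition.\<close>

definition weakly_p_Cauchy :: "real \<Rightarrow> (nat \<Rightarrow> 'a::real_normed_vector) \<Rightarrow> bool" where
  "weakly_p_Cauchy p x \<longleftrightarrow>
     (\<forall>m n. strict_mono m \<and> strict_mono n \<longrightarrow>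
        (\<lambda>k::nat. x (m k) - x (n k)) \<in> weakly_p_summable p)"

definition weakly_p_precompact :: "real \<Rightarrow> 'a::real_normed_vector set \<Rightarrow> bool" where
  "weakly_p_precompact p S \<longleftrightarrow>
     (\<forall>x :: nat \<Rightarrow> 'a. range x \<subseteq> S \<longrightarrow>
        (\<exists>r :: nat \<Rightarrow> nat. strict_mono r \<and> weakly_p_Cauchy p (x \<circ> r)))"

definition compact_operators ::
    "('a::real_normed_vector \<Rightarrow>\<^sub>L 'b::real_normed_vector) set" where
  "compact_operators = {T. compact (closure (blinfun_apply T ` cball 0 1))}"

text \<open>The supremum is taken in \<^typ>\<open>ennreal\<close>, so that it is 0 for the empty
  set of operators and infinite for an unbounded set of values.\<close>

definition uniformly_p_convergent ::
    "real \<Rightarrow> ('a::real_normed_vector \<Rightarrow>\<^sub>L 'b::real_normed_vector) set \<Rightarrow> bool" where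
  "uniformly_p_convergent p K \<longleftrightarrow>
     (\<forall>x \<in> weakly_p_summable p.
        (\<lambda>n. SUP T\<in>K. ennreal (norm (blinfun_apply T (x n)))) \<longlonglongrightarrow> 0)"

text \<open>The real supremum is well-behaved here, since a norm-null sequence of functionals is
  bounded.\<close>

definition equicompact ::
    "('a::real_normed_vector \<Rightarrow>\<^sub>L 'b::real_normed_vector) set \<Rightarrow> bool" where
  "equicompact M \<longleftrightarrow>
     (\<exists>f :: nat \<Rightarrow> ('a \<Rightarrow>\<^sub>L real). (\<lambda>n. norm (f n)) \<longlonglongrightarrow> 0 \<and>
        (\<forall>x. \<forall>T\<in>M. norm (blinfun_apply T x) \<le> (SUP n. \<bar>blinfun_apply (f n) x\<bar>)))"

end

theory Submission
  imports Defs
begin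

text \<open>
  If \<^term>\<open>M\<close> is equicompact with null sequence $(f_n)$ and $(x_k)$ is weakly $p$-summable, then
  $|f_n(x_k)|$ is small for large $n$ uniformly in $k$, by the uniform boundedness principle on
  the dual, and each of the remaining finitely many $f_n$ satisfies $f_n(x_k) \to 0$.

  Conversely let $q(x) = \sup_{T \in M} \|T x\|$. A $q$-separated sequence in the unit ball would
  have a weakly $p$-Cauchy subsequence, whose consecutive differences $q$ does not send to 0;
  hence the unit ball is totally bounded for $q$. As in Ascoli's theorem, the set of functionals
  dominated by $q$ is then totally bounded in the dual norm, so by Grothendieck's lemma it lies in
  the closed convex hull of a null sequence. By Hahn--Banach, $q(x)$ is attained on that set.
\<close>

section \<open>Sublinear functionals and the Hahn-Banach theorem\<close>

definition sublinear :: "('a::real_vector \<Rightarrow> real) \<Rightarrow> bool" where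
  "sublinear p \<longleftrightarrow> (\<forall>x y. p (x + y) \<le> p x + p y) \<and> (\<forall>c x. 0 \<le> c \<longrightarrow> p (c *\<^sub>R x) = c * p x)"

lemma sublinear_add: "sublinear p \<Longrightarrow> p (x + y) \<le> p x + p y"
  and sublinear_scaleR: "sublinear p \<Longrightarrow> 0 \<le> c \<Longrightarrow> p (c *\<^sub>R x) = c * p x"
  by (auto simp: sublinear_def)

lemma sublinear_zero: "sublinear p \<Longrightarrow> p 0 = 0"
  using sublinear_scaleR[of p 0 0] by simp

lemma sublinear_minus: "sublinear p \<Longrightarrow> - p (- x) \<le> p x"
  using sublinear_add[of p x "- x"] by (simp add: sublinear_zero)

text \<open>For c > 0 the reverse inequality comes from scaling \<open>c *\<^sub>R x\<close> back by
  \<open>inverse c\<close>; for c = 0, subadditivity at 0 gives \<open>0 \<le> p 0\<close>.\<close>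

lemma sublinearI:
  assumes add: "\<And>x y. p (x + y) \<le> p x + p y"
    and scaleR: "\<And>c x. 0 \<le> c \<Longrightarrow> p (c *\<^sub>R x) \<le> c * p x"
  shows "sublinear p"
  unfolding sublinear_def
proof (intro conjI allI impI)
  fix c :: real and x assume "0 \<le> c"
  show "p (c *\<^sub>R x) = c * p x"
  proof (cases "c = 0")
    case True
    then show ?thesis using scaleR[of 0 x] add[of 0 0] by simp
  next
    case False
    with \<open>0 \<le> c\<close> have "0 < c" by simp
    then have "p x \<le> inverse c * p (c *\<^sub>R x)"
      using scaleR[of "inverse c" "c *\<^sub>R x"] by simp
    then have "c * p x \<le> p (c *\<^sub>R x)"
      using \<open>0 < c\<close> by (simp add: field_simps)
    with scaleR[OF \<open>0 \<le> c\<close>, of x] show ?thesis by linarith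
  qed
qed (rule add)

text \<open>This is the descent step for Hahn-Banach: when \<open>p\<close> is minimal,
  \<open>r\<close> must equal \<open>p\<close>, so \<open>p (- y) \<le> - p y\<close> for every y,
  which makes \<open>p\<close> odd and hence linear. The witness is the infimum of
  \<open>p (x + t *\<^sub>R y) - t * p y\<close> over t >= 0; t = 0 yields \<open>r \<le> p\<close>,
  and t = 1 at the point \<open>- y\<close> yields the last claim.\<close>

lemma sublinear_decrease:
  assumes p: "sublinear p"
  obtains r where "sublinear r" "r \<le> p" "r (- y) \<le> - p y"
proof -
  define v where "v x t = p (x + t *\<^sub>R y) - t * p y" for x t
  define r where "r x = (INF t\<in>{0..}. v x t)" for x
  have bdd: "bdd_below (v x ` {0..})" for x
  proof (rule bdd_belowI2)
    fix t :: real assume "t \<in> {0..}"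
    then have "t * p y = p ((x + t *\<^sub>R y) + - x)" using p by (simp add: sublinear_scaleR)
    also have "\<dots> \<le> p (x + t *\<^sub>R y) + p (- x)" using p by (rule sublinear_add)
    finally show "- p (- x) \<le> v x t" by (simp add: v_def)
  qed
  have r_le: "r x \<le> v x t" if "0 \<le> t" for x t
    unfolding r_def using that by (intro cINF_lower bdd) auto
  have le_r: "a \<le> r x" if "\<And>t. 0 \<le> t \<Longrightarrow> a \<le> v x t" for a x
    unfolding r_def using that by (intro cINF_greatest) auto
  have "sublinear r"
  proof (rule sublinearI)
    fix x z
    \<comment> \<open>The parameters add: s for x and t for z combine to s + t for x + z. The two
      infima are then taken one after the other.\<close>
    have "r (x + z) \<le> v x s + v z t" if "0 \<le> s" "0 \<le> t" for s t
    proof -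
      have "r (x + z) \<le> v (x + z) (s + t)" using that by (intro r_le) simp
      also have "\<dots> \<le> v x s + v z t"
        using sublinear_add[OF p, of "x + s *\<^sub>R y" "z + t *\<^sub>R y"] by (simp add: v_def algebra_simps)
      finally show ?thesis .
    qed
    then have "r (x + z) - v z t \<le> r x" if "0 \<le> t" for t
      using that by (intro le_r) (simp add: algebra_simps)
    then have "r (x + z) - r x \<le> r z"
      by (intro le_r) (simp add: algebra_simps)
    then show "r (x + z) \<le> r x + r z" by simp
  next
    fix c :: real and x assume "0 \<le> c"
    show "r (c *\<^sub>R x) \<le> c * r x"
    proof (cases "c = 0")
      case True
      then show ?thesis using r_le[of 0 0] p by (simp add: v_def sublinear_zero)
    next
      case False
      with \<open>0 \<le> c\<close> have "0 < c" by simp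
      \<comment> \<open>The parameter scales along with the vector: t for x corresponds to c * t for
        \<open>c *\<^sub>R x\<close>.\<close>
      have "r (c *\<^sub>R x) / c \<le> v x t" if "0 \<le> t" for t
      proof -
        have "r (c *\<^sub>R x) \<le> v (c *\<^sub>R x) (c * t)" using that \<open>0 \<le> c\<close> by (intro r_le) simp
        also have "\<dots> = c * v x t"
          using sublinear_scaleR[OF p \<open>0 \<le> c\<close>, of "x + t *\<^sub>R y"] by (simp add: v_def algebra_simps)
        finally show ?thesis using \<open>0 < c\<close> by (simp add: field_simps)
      qed
      then have "r (c *\<^sub>R x) / c \<le> r x" by (rule le_r)
      then show ?thesis using \<open>0 < c\<close> by (simp add: field_simps)
    qed
  qed
  moreover have "r \<le> p"
    using r_le[of 0] by (auto simp: le_fun_def v_def)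
  moreover have "r (- y) \<le> - p y"
    using r_le[of 1 "- y"] p by (simp add: v_def sublinear_zero)
  ultimately show ?thesis by (rule that)
qed

text \<open>Zorn's lemma for the reversed pointwise order: the pointwise infimum of a nonempty chain
  is again sublinear and lies below every member.\<close>

lemma exists_minimal_sublinear:
  assumes p: "sublinear p"
  obtains m where "sublinear m" "m \<le> p" "\<And>r. sublinear r \<Longrightarrow> r \<le> m \<Longrightarrow> r = m"
proof -
  define A where "A = {g. sublinear g \<and> g \<le> p}"
  have "\<exists>m\<in>A. \<forall>a\<in>A. a \<le> m \<longrightarrow> a = m"
  proof (rule predicate_Zorn)
    show "partial_order_on A (relation_of (\<lambda>f g. g \<le> f) A)"
      by (auto simp: partial_order_on_def preorder_on_def relation_of_def refl_on_def
          trans_def antisym_def)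
    fix C assume "C \<in> Chains (relation_of (\<lambda>f g. g \<le> f) A)"
    then have C: "\<And>f g. f \<in> C \<Longrightarrow> g \<in> C \<Longrightarrow> f \<le> g \<or> g \<le> f" and CA: "C \<subseteq> A"
      by (auto simp: Chains_def relation_of_def)
    show "\<exists>u\<in>A. \<forall>a\<in>C. u \<le> a"
    proof (cases "C = {}")
      case True
      then show ?thesis using p by (auto simp: A_def)
    next
      case False
      define u where "u x = (INF g\<in>C. g x)" for x
      \<comment> \<open>The infimum is finite because
        \<open>- p (- x) \<le> - g (- x) \<le> g x\<close>, a bound that does not depend on
        g.\<close>
      have bdd: "bdd_below ((\<lambda>g. g x) ` C)" for x
      proof (rule bdd_belowI2)
        fix g assume "g \<in> C"
        then have "sublinear g" "g (- x) \<le> p (- x)" using CA by (auto simp: A_def le_fun_def)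
        then show "- p (- x) \<le> g x" using sublinear_minus[of g x] by linarith
      qed
      have u_le: "u x \<le> g x" if "g \<in> C" for g x
        unfolding u_def using that by (intro cINF_lower bdd)
      have le_u: "a \<le> u x" if "\<And>g. g \<in> C \<Longrightarrow> a \<le> g x" for a x
        unfolding u_def using that False by (intro cINF_greatest)
      have "sublinear u"
      proof (rule sublinearI)
        fix x y
        have "u (x + y) \<le> f x + g y" if "f \<in> C" "g \<in> C" for f g
        proof -
          \<comment> \<open>Comparability in the chain is what gives subadditivity: the smaller of f
            and g serves for both summands.\<close>
          define h where "h = (if f \<le> g then f else g)"
          have h: "h \<in> C" "h \<le> f" "h \<le> g" using C[OF that] that by (auto simp: h_def)
          have "u (x + y) \<le> h (x + y)" using h by (intro u_le)
          also have "\<dots> \<le> h x + h y" using h CA by (intro sublinear_add) (auto simp: A_def)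
          also have "\<dots> \<le> f x + g y" using h by (intro add_mono) (auto simp: le_fun_def)
          finally show ?thesis .
        qed
        then have "u (x + y) - g y \<le> u x" if "g \<in> C" for g
          using that by (intro le_u) (simp add: algebra_simps)
        then have "u (x + y) - u x \<le> u y"
          by (intro le_u) (simp add: algebra_simps)
        then show "u (x + y) \<le> u x + u y" by simp
      next
        fix c :: real and x assume "0 \<le> c"
        show "u (c *\<^sub>R x) \<le> c * u x"
        proof (cases "c = 0")
          case True
          obtain g where "g \<in> C" using False by blast
          then show ?thesis using True u_le[of g 0] CA by (auto simp: A_def sublinear_zero)
        next
          case False
          with \<open>0 \<le> c\<close> have "0 < c" by simp
          have "u (c *\<^sub>R x) / c \<le> g x" if "g \<in> C" for g
          proof -
            have "g (c *\<^sub>R x) = c * g x"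
              using CA that \<open>0 \<le> c\<close> by (intro sublinear_scaleR) (auto simp: A_def)
            with u_le[OF that, of "c *\<^sub>R x"] show ?thesis using \<open>0 < c\<close> by (simp add: field_simps)
          qed
          then have "u (c *\<^sub>R x) / c \<le> u x" by (rule le_u)
          then show ?thesis using \<open>0 < c\<close> by (simp add: field_simps)
        qed
      qed
      moreover have "u \<le> p"
      proof -
        obtain g where "g \<in> C" using False by blast
        then have "u \<le> g" "g \<le> p" using u_le CA by (auto simp: le_fun_def A_def)
        then show ?thesis by (rule order_trans)
      qed
      ultimately show ?thesis using u_le by (auto simp: A_def le_fun_def intro!: bexI[of _ u])
    qed
  qed
  then obtain m where m: "m \<in> A" and min: "\<And>a. a \<in> A \<Longrightarrow> a \<le> m \<Longrightarrow> a = m" by blast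
  show ?thesis
  proof (rule that)
    show "sublinear m" "m \<le> p" using m by (auto simp: A_def)
    show "r = m" if "sublinear r" "r \<le> m" for r
      using that \<open>m \<le> p\<close> by (intro min) (auto simp: A_def)
  qed
qed

text \<open>Decreasing \<open>p\<close> along \<open>x0\<close> first forces every sublinear f below
  \<open>r\<close> to satisfy \<open>f (- x0) \<le> - p x0\<close>. A minimal such f is odd, hence
  linear, and oddness turns this bound into \<open>p x0 \<le> f x0\<close>.\<close>

theorem hahn_banach_sublinear:
  assumes p: "sublinear p"
  obtains f where "linear f" "\<And>x. f x \<le> p x" "f x0 = p x0"
proof -
  obtain r where r: "sublinear r" "r \<le> p" "r (- x0) \<le> - p x0"
    using sublinear_decrease[OF p] .
  obtain f where f: "sublinear f" "f \<le> r" and min: "\<And>g. sublinear g \<Longrightarrow> g \<le> f \<Longrightarrow> g = f"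
    using exists_minimal_sublinear[OF r(1)] by blast
  have neg: "f (- y) = - f y" for y
  proof -
    obtain g where g: "sublinear g" "g \<le> f" "g (- y) \<le> - f y"
      using sublinear_decrease[OF f(1)] .
    then have "f (- y) \<le> - f y" using min by blast
    with sublinear_minus[OF f(1), of y] show ?thesis by linarith
  qed
  have "linear f"
  proof (rule linearI)
    fix x y
    have "f x \<le> f (x + y) - f y"
      using sublinear_add[OF f(1), of "x + y" "- y"] by (simp add: neg)
    with sublinear_add[OF f(1), of x y] show "f (x + y) = f x + f y" by linarith
  next
    fix c :: real and x
    show "f (c *\<^sub>R x) = c *\<^sub>R f x"
    proof (cases "0 \<le> c")
      case True
      then show ?thesis using f(1) by (simp add: sublinear_scaleR)
    next
      case False
      then have "f ((- c) *\<^sub>R x) = - c * f x" using f(1) by (intro sublinear_scaleR) simp_all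
      then show ?thesis using neg[of "c *\<^sub>R x"] by simp
    qed
  qed
  moreover have le: "f x \<le> p x" for x
    using f(2) r(2) by (meson le_funD order_trans)
  moreover have "f x0 = p x0"
  proof -
    have "f (- x0) \<le> r (- x0)" using f(2) by (rule le_funD)
    with r(3) have "p x0 \<le> f x0" by (simp add: neg)
    with le[of x0] show ?thesis by linarith
  qed
  ultimately show ?thesis by (rule that)
qed

section \<open>Grothendieck's lemma: totally bounded sets and null sequences\<close>

lemma exists_null_sequence_covering:
  fixes G :: "'v::real_normed_vector set"
  assumes "countable G" and fin: "\<And>e. 0 < e \<Longrightarrow> finite {g \<in> G. e \<le> norm g}"
  obtains f :: "nat \<Rightarrow> 'v" where "f \<longlonglongrightarrow> 0" "G \<subseteq> range f"
proof -
  define c where "c = to_nat_on G"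
  \<comment> \<open>Each element of G sits at a single index and all other indices carry 0, so only
    finitely many indices have a value of norm at least e.\<close>
  define f where "f n = (if n \<in> c ` G then inv_into G c n else 0)" for n
  have inj: "inj_on c G" unfolding c_def using assms(1) by (rule inj_on_to_nat_on)
  have fc: "f (c g) = g" if "g \<in> G" for g
    using that inj by (simp add: f_def)
  have "f \<longlonglongrightarrow> 0"
  proof (rule tendstoI)
    fix e :: real assume e: "0 < e"
    have "{n. \<not> dist (f n) 0 < e} \<subseteq> c ` {g \<in> G. e \<le> norm g}"
    proof
      fix n assume "n \<in> {n. \<not> dist (f n) 0 < e}"
      then have n: "e \<le> norm (f n)" by simp
      with e have "n \<in> c ` G" by (auto simp: f_def split: if_splits)
      then obtain g where "g \<in> G" "n = c g" by blast
      with n show "n \<in> c ` {g \<in> G. e \<le> norm g}" by (auto simp: fc)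
    qed
    then show "\<forall>\<^sub>F n in sequentially. dist (f n) 0 < e"
      using fin[OF e] by (metis (no_types) cofinite_eq_sequentially eventually_cofinite finite_imageI finite_subset)
  qed
  moreover have "G \<subseteq> range f" using fc by (metis rangeI subsetI)
  ultimately show ?thesis by (rule that)
qed

text \<open>A point k is the limit of net points \<open>a i\<close> with \<open>a 0 = 0\<close>, so
  it is the sum of the differences \<open>a (Suc i) - a i\<close>, of order
  \<open>1 / 4 ^ i\<close>. Multiplied by \<open>2 ^ Suc i\<close> these still tend to 0, and the
  compensating weights \<open>1 / 2 ^ Suc i\<close> sum to 1. Each level has only finitely many
  differences, so all of them fit into one null sequence.\<close>

theorem totally_bounded_subset_closure_convex_hull_null_sequence:
  fixes K :: "'v::real_normed_vector set"
  assumes tb: "\<And>e. 0 < e \<Longrightarrow> \<exists>N. finite N \<and> K \<subseteq> (\<Union>a\<in>N. cball a e)"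
  obtains f :: "nat \<Rightarrow> 'v" where "f \<longlonglongrightarrow> 0" "K \<subseteq> closure (convex hull (range f))"
proof -
  have "\<forall>i. \<exists>N. finite N \<and> K \<subseteq> (\<Union>a\<in>N. cball a (1 / 4 ^ i))"
    using tb by simp
  then obtain N0 where N0: "\<And>i. finite (N0 i)" "\<And>i. K \<subseteq> (\<Union>a\<in>N0 i. cball a (1 / 4 ^ i))"
    by metis
  \<comment> \<open>Level 0 is replaced by {0} so that the telescoping starts at 0. It need not be
    close to K, so the size condition in \<open>D\<close> exempts i = 0.\<close>
  define N where "N i = (if i = 0 then {0} else N0 i)" for i :: nat
  define D where "D i = {2 ^ Suc i *\<^sub>R (b - a) | a b. a \<in> N i \<and> b \<in> N (Suc i) \<and>
      (i = 0 \<or> norm (b - a) \<le> 2 / 4 ^ i)}" for i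
  define G where "G = insert 0 (\<Union>i. D i)"
  have finD: "finite (D i)" for i
  proof (rule finite_subset)
    show "D i \<subseteq> (\<lambda>(a, b). 2 ^ Suc i *\<^sub>R (b - a)) ` (N i \<times> N (Suc i))"
      by (auto simp: D_def)
    show "finite ((\<lambda>(a, b). (2::real) ^ Suc i *\<^sub>R (b - a)) ` (N i \<times> N (Suc i)))"
      using N0(1) by (auto simp: N_def)
  qed
  have "countable G"
    unfolding G_def using finD by (intro countable_insert countable_UN) (auto intro: countable_finite)
  moreover have "finite {g \<in> G. e \<le> norm g}" if "0 < e" for e
  proof -
    obtain n :: nat where n: "(1 / 2) ^ n < e / 4"
      using real_arch_pow_inv[of "e / 4" "1 / 2"] \<open>0 < e\<close> by auto
    have "{g \<in> G. e \<le> norm g} \<subseteq> (\<Union>i\<le>n. D i)"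
    proof
      fix g assume "g \<in> {g \<in> G. e \<le> norm g}"
      then have g: "g \<in> G" "e \<le> norm g" by auto
      with \<open>0 < e\<close> obtain i where i: "g \<in> D i" by (auto simp: G_def)
      have "i \<le> n"
      proof (rule ccontr)
        assume "\<not> i \<le> n"
        then have "n < i" by simp
        with i obtain h where h: "g = 2 ^ Suc i *\<^sub>R h" "norm h \<le> 2 / 4 ^ i" by (auto simp: D_def)
        then have "norm g = 2 ^ Suc i * norm h" by simp
        also have "\<dots> \<le> 2 ^ Suc i * (2 / 4 ^ i)" using h(2) by (rule mult_left_mono) simp
        also have "\<dots> = 4 * (2 / 4) ^ i" by (simp only: power_divide) simp
        also have "\<dots> \<le> 4 * (1 / 2) ^ n"
          using \<open>n < i\<close> power_decreasing[of n i "1 / 2 :: real"] by simp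
        also have "\<dots> < e" using n by simp
        finally show False using g by simp
      qed
      with i show "g \<in> (\<Union>i\<le>n. D i)" by blast
    qed
    then show ?thesis by (rule finite_subset) (simp add: finD)
  qed
  ultimately obtain f where f: "f \<longlonglongrightarrow> 0" "G \<subseteq> range f"
    using exists_null_sequence_covering by metis
  define C where "C = convex hull (range f)"
  have GC: "g \<in> C" if "g \<in> G" for g
    using that f(2) unfolding C_def by (intro hull_inc) blast
  have conv: "convex C" unfolding C_def by (rule convex_convex_hull)
  have "k \<in> closure C" if k: "k \<in> K" for k
  proof -
    have "\<forall>i. \<exists>a. a \<in> N i \<and> (i \<noteq> 0 \<longrightarrow> dist a k \<le> 1 / 4 ^ i)"
      using N0(2) k by (force simp: N_def)
    then obtain a where a: "\<And>i. a i \<in> N i" "\<And>i. i \<noteq> 0 \<Longrightarrow> dist (a i) k \<le> 1 / 4 ^ i"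
      by metis
    have D: "2 ^ Suc i *\<^sub>R (a (Suc i) - a i) \<in> C" for i
    proof -
      have "norm (a (Suc i) - a i) \<le> 2 / 4 ^ i" if "i \<noteq> 0"
      proof -
        have "norm (a (Suc i) - a i) \<le> dist (a (Suc i)) k + dist (a i) k"
          by (metis dist_commute dist_norm dist_triangle)
        also have "\<dots> \<le> 1 / 4 ^ Suc i + 1 / 4 ^ i"
          using a(2)[of i] a(2)[of "Suc i"] that by simp
        also have "\<dots> \<le> 2 / 4 ^ i" by (simp add: field_simps)
        finally show ?thesis .
      qed
      then have "2 ^ Suc i *\<^sub>R (a (Suc i) - a i) \<in> D i"
        using a(1) by (fastforce simp: D_def)
      then show ?thesis by (intro GC) (auto simp: G_def)
    qed
    \<comment> \<open>The remainder of the dyadic weights is put on an arbitrary point of the hull.\<close>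
    have "\<forall>c\<in>C. a i + (1 / 2 ^ i) *\<^sub>R c \<in> C" for i
    proof (induction i)
      case 0
      have "a 0 = 0" using a(1)[of 0] by (simp add: N_def)
      then show ?case by simp
    next
      case (Suc i)
      show ?case
      proof
        fix c assume "c \<in> C"
        define d where "d = 2 ^ Suc i *\<^sub>R (a (Suc i) - a i)"
        have "(1 / 2) *\<^sub>R d + (1 / 2) *\<^sub>R c \<in> C"
          using D[of i] \<open>c \<in> C\<close> conv by (intro convexD) (auto simp: d_def)
        with Suc have "a i + (1 / 2 ^ i) *\<^sub>R ((1 / 2) *\<^sub>R d + (1 / 2) *\<^sub>R c) \<in> C" by blast
        also have "a i + (1 / 2 ^ i) *\<^sub>R ((1 / 2) *\<^sub>R d + (1 / 2) *\<^sub>R c)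
            = a (Suc i) + (1 / 2 ^ Suc i) *\<^sub>R c"
          by (simp add: d_def scaleR_add_right)
        finally show "a (Suc i) + (1 / 2 ^ Suc i) *\<^sub>R c \<in> C" .
      qed
    qed
    moreover have "0 \<in> C" by (intro GC) (simp add: G_def)
    \<comment> \<open>The remaining weight is put on 0, which was inserted into \<open>G\<close> for
      this purpose.\<close>
    ultimately have "a i \<in> C" for i by fastforce
    moreover have "a \<longlonglongrightarrow> k"
    proof (rule metric_tendsto_imp_tendsto)
      show "(\<lambda>i. (1 / 4) ^ i :: real) \<longlonglongrightarrow> 0" by (rule LIMSEQ_realpow_zero) auto
      show "\<forall>\<^sub>F i in sequentially. dist (a i) k \<le> dist ((1 / 4) ^ i) (0::real)"
        using eventually_gt_at_top[of 0] by eventually_elim (use a(2) in \<open>auto simp: power_divide\<close>)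
    qed
    ultimately show ?thesis unfolding closure_sequential by blast
  qed
  then show ?thesis using f(1) that unfolding C_def by blast
qed

section \<open>Operator norms and the uniform boundedness principle\<close>

lemma norm_blinfun_bound_unit:
  assumes "\<And>x. norm x \<le> 1 \<Longrightarrow> norm (blinfun_apply f x) \<le> b"
  shows "norm f \<le> b"
proof (rule norm_blinfun_bound)
  show "0 \<le> b" using assms[of 0] by simp
  show "norm (blinfun_apply f x) \<le> b * norm x" for x
  proof (cases "x = 0")
    case False
    then have "norm (blinfun_apply f (inverse (norm x) *\<^sub>R x)) \<le> b" by (intro assms) simp
    then show ?thesis using False by (simp add: blinfun.scaleR_right field_simps)
  qed simp
qed

theorem uniform_boundedness:
  fixes S :: "('a::banach \<Rightarrow>\<^sub>L 'b::real_normed_vector) set"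
  assumes bdd: "\<And>x. bounded ((\<lambda>g. blinfun_apply g x) ` S)"
  shows "bounded S"
proof -
  define T where "T n = {x. \<forall>g\<in>S. norm (blinfun_apply g x) \<le> real n}" for n
  have closed: "closed (T n)" for n
  proof -
    have "T n = (\<Inter>g\<in>S. {x. norm (blinfun_apply g x) \<le> real n})" by (auto simp: T_def)
    also have "closed \<dots>"
      by (intro closed_INT ballI closed_Collect_le continuous_intros)
    finally show ?thesis .
  qed
  have "(\<Union>n. T n) = UNIV"
  proof -
    have "\<exists>n. x \<in> T n" for x
    proof -
      obtain b where b: "\<And>g. g \<in> S \<Longrightarrow> norm (blinfun_apply g x) \<le> b"
        using bdd[of x] by (auto simp: bounded_iff)
      obtain n where "b \<le> real n" using real_arch_simple by blast
      with b have "x \<in> T n" by (auto simp: T_def intro: order_trans)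
      then show ?thesis ..
    qed
    then show ?thesis by blast
  qed
  \<comment> \<open>By Baire's theorem a countable union of closed sets with empty interior has
    empty interior, so some \<open>T n\<close> contains a ball.\<close>
  then have "euclidean interior_of \<Union>(range T) \<noteq> {}" by simp
  then have "\<exists>n. interior (T n) \<noteq> {}"
    using Baire_category_alt[of euclidean "range T"] closed
    by (auto simp: completely_metrizable_space_euclidean)
  then obtain n x0 where "x0 \<in> interior (T n)" by blast
  then obtain r where r: "0 < r" "cball x0 r \<subseteq> T n" using mem_interior_cball by blast
  \<comment> \<open>\<open>r *\<^sub>R g z\<close> is the difference of the values of g at
    \<open>x0 + r *\<^sub>R z\<close> and at \<open>x0\<close>, each of norm at most n.\<close>
  have "norm g \<le> 2 * real n / r" if "g \<in> S" for g
  proof (rule norm_blinfun_bound_unit)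
    fix z :: 'a assume "norm z \<le> 1"
    then have "x0 + r *\<^sub>R z \<in> T n" "x0 \<in> T n" using r by (auto simp: subset_iff dist_norm)
    then have "norm (g (x0 + r *\<^sub>R z)) \<le> n" "norm (g x0) \<le> n" using that by (auto simp: T_def)
    then have "norm (r *\<^sub>R g z) \<le> 2 * real n"
      using norm_triangle_ineq4[of "g (x0 + r *\<^sub>R z)" "g x0"]
      by (simp add: blinfun.add_right blinfun.scaleR_right)
    then show "norm (g z) \<le> 2 * real n / r" using r(1) by (simp add: field_simps)
  qed
  then show ?thesis by (auto simp: bounded_iff)
qed

section \<open>Weakly p-summable sequences and the forward implication\<close>

lemma weakly_p_summable_tendsto_0:
  fixes f :: "'a::real_normed_vector \<Rightarrow>\<^sub>L real"
  assumes "0 < p" "x \<in> weakly_p_summable p"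
  shows "(\<lambda>k. blinfun_apply f (x k)) \<longlonglongrightarrow> 0"
proof -
  have "(\<lambda>k. \<bar>blinfun_apply f (x k)\<bar> powr p) \<longlonglongrightarrow> 0"
    using assms(2) by (intro summable_LIMSEQ_zero) (simp add: weakly_p_summable_def little_lp_def)
  then have "(\<lambda>k. (\<bar>blinfun_apply f (x k)\<bar> powr p) powr (1 / p)) \<longlonglongrightarrow> 0 powr (1 / p)"
    using assms(1) by (intro tendsto_powr') auto
  then show ?thesis
    using assms(1) by (simp add: powr_powr tendsto_rabs_zero_iff)
qed

\<comment> \<open>Bounding the evaluations on the dual instead of the norms avoids norming functionals.\<close>
lemma weakly_p_summable_bounded:
  fixes x :: "nat \<Rightarrow> 'a::real_normed_vector"
  assumes "0 < p" "x \<in> weakly_p_summable p"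
  obtains B where "0 < B" "\<And>(f :: 'a \<Rightarrow>\<^sub>L real) k. \<bar>blinfun_apply f (x k)\<bar> \<le> B * norm f"
proof -
  \<comment> \<open>The \<open>ev k\<close> are functionals on the dual, which is complete because
    the scalars are, so uniform boundedness applies to them.\<close>
  define ev :: "nat \<Rightarrow> ('a \<Rightarrow>\<^sub>L real) \<Rightarrow>\<^sub>L real" where "ev k = Blinfun (\<lambda>f. blinfun_apply f (x k))" for k
  have ev: "blinfun_apply (ev k) f = blinfun_apply f (x k)" for k f
    unfolding ev_def
    by (simp add: bounded_linear_Blinfun_apply bounded_bilinear.bounded_linear_left[OF bounded_bilinear_blinfun_apply])
  have "bounded (range ev)"
  proof (rule uniform_boundedness)
    fix f :: "'a \<Rightarrow>\<^sub>L real"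
    have "bounded (range (\<lambda>k. blinfun_apply f (x k)))"
      using weakly_p_summable_tendsto_0[OF assms] by (rule convergent_imp_bounded)
    then show "bounded ((\<lambda>g. blinfun_apply g f) ` range ev)" by (simp add: image_image ev)
  qed
  then obtain B where B: "0 < B" "\<And>k. norm (ev k) \<le> B" by (auto simp: bounded_pos)
  have "\<bar>blinfun_apply f (x k)\<bar> \<le> B * norm f" for f k
    using norm_blinfun[of "ev k" f] mult_right_mono[OF B(2)[of k], of "norm f"] by (simp add: ev)
  with B(1) show ?thesis by (rule that)
qed

theorem equicompact_imp_uniformly_p_convergent:
  fixes M :: "('a::real_normed_vector \<Rightarrow>\<^sub>L 'b::real_normed_vector) set"
  assumes p: "0 < p" and "equicompact M"
  shows "uniformly_p_convergent p M"
  unfolding uniformly_p_convergent_def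
proof
  fix x :: "nat \<Rightarrow> 'a" assume x: "x \<in> weakly_p_summable p"
  obtain f where f: "(\<lambda>n. norm (f n)) \<longlonglongrightarrow> 0"
    and M: "\<And>y T. T \<in> M \<Longrightarrow> norm (blinfun_apply T y) \<le> (SUP n. \<bar>blinfun_apply (f n) y\<bar>)"
    using assms(2) unfolding equicompact_def by blast
  obtain B where B: "0 < B" "\<And>(f::'a \<Rightarrow>\<^sub>L real) k. \<bar>blinfun_apply f (x k)\<bar> \<le> B * norm f"
    using weakly_p_summable_bounded[OF p x] by metis
  \<comment> \<open>\<open>s k\<close> dominates all \<open>norm (blinfun_apply T (x k))\<close>
    with T in M at once, so it suffices that s tends to 0.\<close>
  define s where "s k = (SUP n. \<bar>blinfun_apply (f n) (x k)\<bar>)" for k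
  have "s \<longlonglongrightarrow> 0"
  proof (rule tendstoI)
    fix e :: real assume e: "0 < e"
    \<comment> \<open>From N on, \<open>B * norm (f n)\<close> is below e / 2, which bounds the
      values at all \<open>x k\<close> simultaneously; finitely many functionals remain.\<close>
    obtain N where N: "\<And>n. N \<le> n \<Longrightarrow> norm (f n) < e / 2 / B"
      using order_tendstoD(2)[OF f, of "e / 2 / B"] e B(1) by (auto simp: eventually_sequentially)
    have "\<forall>\<^sub>F k in sequentially. \<bar>blinfun_apply (f n) (x k)\<bar> < e / 2" for n
      using tendstoD[OF weakly_p_summable_tendsto_0[OF p x], of "e / 2" "f n"] e by simp
    then have "\<forall>\<^sub>F k in sequentially. \<forall>n\<in>{..<N}. \<bar>blinfun_apply (f n) (x k)\<bar> < e / 2"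
      by (intro eventually_ball_finite) auto
    then show "\<forall>\<^sub>F k in sequentially. dist (s k) 0 < e"
    proof eventually_elim
      case (elim k)
      have le: "\<bar>blinfun_apply (f n) (x k)\<bar> \<le> e / 2" for n
      proof (cases "n < N")
        case True
        then show ?thesis using elim by (simp add: less_imp_le)
      next
        case False
        then have "B * norm (f n) \<le> e / 2"
          using N[of n] B(1) by (simp add: field_simps)
        then show ?thesis using B(2)[of "f n" k] by linarith
      qed
      then have "s k \<le> e / 2" unfolding s_def by (intro cSUP_least) auto
      moreover have "0 \<le> s k"
        unfolding s_def using le by (intro cSUP_upper2[where x = 0] bdd_aboveI2[where M = "e / 2"]) auto
      ultimately show ?case using e by simp
    qed
  qed
  then have "(\<lambda>k. ennreal (s k)) \<longlonglongrightarrow> 0" using tendsto_ennrealI by fastforce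
  then show "(\<lambda>k. SUP T\<in>M. ennreal (norm (blinfun_apply T (x k)))) \<longlonglongrightarrow> 0"
    by (rule tendsto_sandwich[OF _ _ tendsto_const, rotated 2])
      (auto simp: s_def M intro!: always_eventually SUP_least ennreal_leI)
qed

section \<open>Seminorms for which the unit ball is totally bounded\<close>

text \<open>A dominated functional varies by at most \<open>\<delta>\<close> between a point of the
  ball and a nearby net point, so its values on the finite net, rounded to multiples of
  \<open>\<delta>\<close>, determine it up to \<open>3 * \<delta>\<close> in norm.\<close>

lemma totally_bounded_dominated_functionals:
  fixes q :: "'a::real_normed_vector \<Rightarrow> real"
  assumes tb: "\<And>e. 0 < e \<Longrightarrow> \<exists>D. finite D \<and> (\<forall>x\<in>cball 0 1. \<exists>d\<in>D. q (x - d) \<le> e)"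
    and e: "0 < e"
  shows "\<exists>N. finite N \<and> {f::'a \<Rightarrow>\<^sub>L real. \<forall>x. \<bar>blinfun_apply f x\<bar> \<le> q x} \<subseteq> (\<Union>a\<in>N. cball a e)"
proof -
  define K where "K = {f::'a \<Rightarrow>\<^sub>L real. \<forall>x. \<bar>blinfun_apply f x\<bar> \<le> q x}"
  define \<delta> where "\<delta> = e / 3"
  have \<delta>: "0 < \<delta>" using e by (simp add: \<delta>_def)
  then obtain D where D: "finite D" "\<And>x. norm x \<le> 1 \<Longrightarrow> \<exists>d\<in>D. q (x - d) \<le> \<delta>"
    using tb[of \<delta>] by auto
  \<comment> \<open>\<open>c f\<close> is the rounding pattern of f on D. Domination by q confines
    each entry to a finite integer interval, so only finitely many patterns occur.\<close>
  define c where "c f = restrict (\<lambda>d. \<lfloor>blinfun_apply f d / \<delta>\<rfloor>) D" for f :: "'a \<Rightarrow>\<^sub>L real"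
  have "c ` K \<subseteq> (\<Pi>\<^sub>E d\<in>D. {\<lfloor>- q d / \<delta>\<rfloor>..\<lfloor>q d / \<delta>\<rfloor>})"
  proof (intro subsetI, elim imageE, simp only:, intro PiE_I)
    fix f d assume "f \<in> K" "d \<in> D"
    then have "- q d \<le> blinfun_apply f d" "blinfun_apply f d \<le> q d"
      by (auto simp: K_def abs_le_iff minus_le_iff)
    then have "\<lfloor>- q d / \<delta>\<rfloor> \<le> \<lfloor>blinfun_apply f d / \<delta>\<rfloor>" "\<lfloor>blinfun_apply f d / \<delta>\<rfloor> \<le> \<lfloor>q d / \<delta>\<rfloor>"
      using \<delta> by (intro floor_mono divide_right_mono; simp)+
    then show "c f d \<in> {\<lfloor>- q d / \<delta>\<rfloor>..\<lfloor>q d / \<delta>\<rfloor>}"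
      using \<open>d \<in> D\<close> by (simp add: c_def)
  qed (simp add: c_def)
  then have fin: "finite (c ` K)"
    by (rule finite_subset) (intro finite_PiE D(1) finite_atLeastAtMost_int)
  \<comment> \<open>One representative is kept for each pattern that occurs.\<close>
  define N where "N = inv_into K c ` c ` K"
  have "k \<in> (\<Union>a\<in>N. cball a e)" if k: "k \<in> K" for k
  proof -
    define a where "a = inv_into K c (c k)"
    have a: "a \<in> N" "a \<in> K" "c a = c k"
      using k by (auto simp: a_def N_def intro: inv_into_into f_inv_into_f)
    have "norm (a - k) \<le> e"
    proof (rule norm_blinfun_bound_unit)
      fix x :: 'a assume "norm x \<le> 1"
      then obtain d where d: "d \<in> D" "q (x - d) \<le> \<delta>" using D(2) by blast
      have "\<lfloor>blinfun_apply a d / \<delta>\<rfloor> = \<lfloor>blinfun_apply k d / \<delta>\<rfloor>"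
        using fun_cong[OF a(3), of d] d(1) by (simp add: c_def)
      then have "\<bar>blinfun_apply a d / \<delta> - blinfun_apply k d / \<delta>\<bar> < 1" by linarith
      then have "\<bar>blinfun_apply a d - blinfun_apply k d\<bar> \<le> \<delta>"
        using \<delta> by (simp add: diff_divide_distrib[symmetric])
      moreover have "\<bar>blinfun_apply a (x - d)\<bar> \<le> \<delta>" "\<bar>blinfun_apply k (x - d)\<bar> \<le> \<delta>"
        using a(2) k d(2) by (auto simp: K_def intro: order_trans)
      ultimately show "norm (blinfun_apply (a - k) x) \<le> e"
        unfolding real_norm_def blinfun.diff_left blinfun.diff_right \<delta>_def by linarith
    qed
    then show ?thesis using a(1) by (auto simp: dist_norm)
  qed
  moreover have "finite N" using fin by (simp add: N_def)
  ultimately show ?thesis unfolding K_def by blast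
qed

text \<open>Hahn-Banach provides a functional h below q with \<open>h x = q x\<close>. Symmetry of q
  gives domination of its absolute value and the norm bound gives continuity, so h lies in
  \<open>K\<close>, hence in the closed convex hull of the null sequence.\<close>

theorem seminorm_le_SUP_null_sequence:
  fixes q :: "'a::real_normed_vector \<Rightarrow> real"
  assumes q: "sublinear q" "\<And>x. q (- x) = q x" "\<And>x. q x \<le> B * norm x"
    and tb: "\<And>e. 0 < e \<Longrightarrow> \<exists>D. finite D \<and> (\<forall>x\<in>cball 0 1. \<exists>d\<in>D. q (x - d) \<le> e)"
  obtains f :: "nat \<Rightarrow> 'a \<Rightarrow>\<^sub>L real"
  where "f \<longlonglongrightarrow> 0" "\<And>x. q x \<le> (SUP n. \<bar>blinfun_apply (f n) x\<bar>)"
proof -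
  define K where "K = {f::'a \<Rightarrow>\<^sub>L real. \<forall>x. \<bar>blinfun_apply f x\<bar> \<le> q x}"
  have tb_K: "\<exists>N. finite N \<and> K \<subseteq> (\<Union>a\<in>N. cball a e)" if "0 < e" for e
    unfolding K_def using tb that by (rule totally_bounded_dominated_functionals)
  obtain f where f: "f \<longlonglongrightarrow> 0" "K \<subseteq> closure (convex hull (range f))"
    using totally_bounded_subset_closure_convex_hull_null_sequence[OF tb_K] .
  have "q x \<le> (SUP n. \<bar>blinfun_apply (f n) x\<bar>)" for x
  proof -
    obtain h where h: "linear h" "\<And>y. h y \<le> q y" "h x = q x"
      using hahn_banach_sublinear[OF q(1)] by blast
    have abs_h: "\<bar>h y\<bar> \<le> q y" for y
      using h(2)[of y] h(2)[of "- y"] by (simp add: linear_neg[OF h(1)] q(2))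
    have "bounded_linear h"
    proof (rule bounded_linear_intro[where K = B])
      show "norm (h y) \<le> norm y * B" for y
        using abs_h[of y] q(3)[of y] by (simp add: mult.commute)
    qed (simp_all add: linear_add[OF h(1)] linear_scale[OF h(1)])
    then have app: "blinfun_apply (Blinfun h) = h" by (rule bounded_linear_Blinfun_apply)
    define S where "S = (SUP n. \<bar>blinfun_apply (f n) x\<bar>)"
    \<comment> \<open>This slab is closed, convex and contains every \<open>f n\<close>, so it
      contains the closed convex hull and with it h.\<close>
    define H where "H = {g::'a \<Rightarrow>\<^sub>L real. \<bar>blinfun_apply g x\<bar> \<le> S}"
    have "bdd_above (range (\<lambda>n. \<bar>blinfun_apply (f n) x\<bar>))"
    proof -
      have "(\<lambda>n. \<bar>blinfun_apply (f n) x\<bar>) \<longlonglongrightarrow> \<bar>blinfun_apply 0 x\<bar>"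
        by (intro tendsto_intros f(1))
      then show ?thesis by (intro bounded_imp_bdd_above convergent_imp_bounded)
    qed
    then have "range f \<subseteq> H" by (auto simp: H_def S_def intro: cSUP_upper)
    moreover have "convex H"
    proof -
      have "H = (\<lambda>g. blinfun_apply g x) -` {- S..S}" by (auto simp: H_def)
      moreover have "linear (\<lambda>g::'a \<Rightarrow>\<^sub>L real. blinfun_apply g x)"
        by (intro linearI) (simp_all add: blinfun.add_left blinfun.scaleR_left)
      ultimately show ?thesis by (simp add: convex_linear_vimage)
    qed
    moreover have "closed H"
      unfolding H_def by (intro closed_Collect_le continuous_intros)
    ultimately have "closure (convex hull (range f)) \<subseteq> H"
      by (intro closure_minimal hull_minimal)
    moreover have "Blinfun h \<in> K" using abs_h by (simp add: K_def app)
    ultimately have "Blinfun h \<in> H" using f(2) by blast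
    then show ?thesis by (simp add: H_def app h(3) S_def)
  qed
  with f(1) show ?thesis by (rule that)
qed

section \<open>Separated sequences and the converse implication\<close>

lemma exists_finite_net_or_separated_sequence:
  fixes q :: "'a::real_vector \<Rightarrow> real"
  assumes "\<not> (\<exists>D. finite D \<and> (\<forall>x\<in>A. \<exists>d\<in>D. q (x - d) \<le> e))"
  obtains x :: "nat \<Rightarrow> 'a" where "range x \<subseteq> A" "\<And>m n. m < n \<Longrightarrow> e < q (x n - x m)"
proof -
  have "\<exists>x. \<forall>n::nat. x n \<in> A \<and> (\<forall>m<n. e < q (x n - x m))"
  proof (rule dependent_wellorder_choice)
    fix n :: nat and x :: "nat \<Rightarrow> 'a"
    \<comment> \<open>The points chosen so far are finitely many and hence no net, so some point of
      A is far from all of them.\<close>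
    have "finite (x ` {..<n})" by simp
    with assms obtain y where "y \<in> A" "\<not> (\<exists>d\<in>x ` {..<n}. q (y - d) \<le> e)" by blast
    then show "\<exists>y. y \<in> A \<and> (\<forall>m<n. e < q (y - x m))" by (auto simp: not_le)
  qed simp
  then show ?thesis using that by blast
qed

theorem uniformly_p_convergent_imp_equicompact:
  fixes M :: "('a::real_normed_vector \<Rightarrow>\<^sub>L 'b::real_normed_vector) set"
  assumes pre: "weakly_p_precompact p (cball (0::'a) 1)"
    and bdd: "bounded M" and unif: "uniformly_p_convergent p M"
  shows "equicompact M"
proof -
  \<comment> \<open>Inserting 0 keeps the supremum meaningful for empty \<^term>\<open>M\<close>.\<close>
  define q where "q x = Sup (insert 0 ((\<lambda>T. norm (blinfun_apply T x)) ` M))" for x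
  obtain B where B: "0 < B" "\<And>T. T \<in> M \<Longrightarrow> norm T \<le> B"
    using bdd by (auto simp: bounded_pos)
  have TB: "norm (blinfun_apply T x) \<le> B * norm x" if "T \<in> M" for T x
    using norm_blinfun[of T x] mult_right_mono[OF B(2)[OF that], of "norm x"] by simp
  have bdd_q: "bdd_above (insert 0 ((\<lambda>T. norm (blinfun_apply T x)) ` M))" for x
    using TB by (auto intro!: bdd_aboveI2)
  have q_upper: "norm (blinfun_apply T x) \<le> q x" if "T \<in> M" for T x
    unfolding q_def using that by (intro cSup_upper bdd_q) auto
  have q_nonneg: "0 \<le> q x" for x
    unfolding q_def by (intro cSup_upper bdd_q) auto
  have q_least: "q x \<le> a" if "0 \<le> a" "\<And>T. T \<in> M \<Longrightarrow> norm (blinfun_apply T x) \<le> a" for a x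
    unfolding q_def using that by (intro cSup_least) auto
  have q_sub: "sublinear q"
  proof (rule sublinearI)
    show "q (x + y) \<le> q x + q y" for x y
    proof (rule q_least)
      fix T assume "T \<in> M"
      then show "norm (blinfun_apply T (x + y)) \<le> q x + q y"
        using norm_triangle_mono[OF q_upper q_upper] by (simp add: blinfun.add_right)
    qed (simp add: q_nonneg)
    show "q (c *\<^sub>R x) \<le> c * q x" if "0 \<le> c" for c x
      using that by (intro q_least) (simp_all add: blinfun.scaleR_right q_nonneg q_upper mult_left_mono)
  qed
  have q_minus: "q (- x) = q x" for x by (simp add: q_def blinfun.minus_right)
  have q_bound: "q x \<le> B * norm x" for x
    using B(1) TB by (intro q_least) auto
  have q_net: "\<exists>D. finite D \<and> (\<forall>x\<in>cball 0 1. \<exists>d\<in>D. q (x - d) \<le> e)" if e: "0 < e" for e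
  proof (rule ccontr)
    assume "\<not> ?thesis"
    from exists_finite_net_or_separated_sequence[OF this]
    obtain x :: "nat \<Rightarrow> 'a" where x: "range x \<subseteq> cball 0 1" "\<And>m n. m < n \<Longrightarrow> e < q (x n - x m)"
      by blast
    obtain r :: "nat \<Rightarrow> nat" where r: "strict_mono r" "weakly_p_Cauchy p (x \<circ> r)"
      using pre x(1) unfolding weakly_p_precompact_def by blast
    \<comment> \<open>Consecutive differences come from the index sequences \<open>Suc\<close> and
      the identity in the weak p-Cauchy condition.\<close>
    define y where "y = (\<lambda>k. x (r (Suc k)) - x (r k))"
    have mono: "strict_mono Suc" "strict_mono (\<lambda>k::nat. k)" by (simp_all add: strict_mono_def)
    have "y \<in> weakly_p_summable p"
      using r(2)[unfolded weakly_p_Cauchy_def, rule_format, OF conjI[OF mono]] by (simp add: y_def)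
    then have "(\<lambda>k. SUP T\<in>M. ennreal (norm (blinfun_apply T (y k)))) \<longlonglongrightarrow> 0"
      using unif by (simp add: uniformly_p_convergent_def)
    then have "\<forall>\<^sub>F k in sequentially. (SUP T\<in>M. ennreal (norm (blinfun_apply T (y k)))) < ennreal e"
      using e by (intro order_tendstoD) auto
    then obtain k where k: "(SUP T\<in>M. ennreal (norm (blinfun_apply T (y k)))) < ennreal e"
      by (auto simp: eventually_sequentially)
    \<comment> \<open>The extended supremum over M differs from q only in its type, so the bound
      carries over to q and contradicts the separation at the indices
      \<open>r k < r (Suc k)\<close>.\<close>
    have "q (y k) \<le> e"
    proof (rule q_least)
      fix T assume "T \<in> M"
      then have "ennreal (norm (blinfun_apply T (y k))) < ennreal e"
        using k by (metis (no_types, lifting) SUP_upper le_less_trans)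
      then show "norm (blinfun_apply T (y k)) \<le> e" by (simp add: ennreal_less_iff)
    qed (use e in simp)
    moreover have "e < q (y k)"
      unfolding y_def using r(1) by (intro x(2)) (simp add: strict_mono_def)
    ultimately show False by simp
  qed
  obtain f :: "nat \<Rightarrow> 'a \<Rightarrow>\<^sub>L real"
    where f: "f \<longlonglongrightarrow> 0" "\<And>x. q x \<le> (SUP n. \<bar>blinfun_apply (f n) x\<bar>)"
    using seminorm_le_SUP_null_sequence[OF q_sub q_minus q_bound q_net] by blast
  show ?thesis unfolding equicompact_def
  proof (intro exI conjI allI ballI)
    show "(\<lambda>n. norm (f n)) \<longlonglongrightarrow> 0" using f(1) by (rule tendsto_norm_zero)
    show "norm (blinfun_apply T x) \<le> (SUP n. \<bar>blinfun_apply (f n) x\<bar>)" if "T \<in> M" for x T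
      using q_upper[OF that] f(2) by (rule order_trans)
  qed
qed

theorem proposition3p2:
  fixes p :: real
    and M :: "('a::banach \<Rightarrow>\<^sub>L 'b::banach) set"
  assumes "1 \<le> p"
    and "weakly_p_precompact p (cball (0::'a) 1)"
    and "M \<subseteq> compact_operators"
    and "bounded M"
  shows "equicompact M \<longleftrightarrow> uniformly_p_convergent p M"
  using assms equicompact_imp_uniformly_p_convergent[of p M]
    uniformly_p_convergent_imp_equicompact[of p M] by linarith

end
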